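(* Let $L \ge \ell \ge 1$ and $n \ge 1$ be integers, and let $\Sigma$ be a finite alphabet of size $q \ge 2$. Let $R, \rho \in [0,1]$ be real numbers such that $$\rho \ \ge\ \frac{L+1-\ell}{L+1} - \frac{L}{L+1}\, R,$$ or equivalently $$R \ \ge\ \frac{L+1-\ell}{L} - \frac{L+1}{L}\,\rho .$$ Then every code $C \subseteq \Sigma^n$ with $|C| \ge q^{Rn+5L}$ is not $(\rho,\ell,L)$ list-recoverable.
   Context: A code $C \subseteq \Sigma^n$ is $(\rho,\ell,L)$ list-recoverable if for every collection of sets $S_1,\dots,S_n \subseteq \Sigma$ with $|S_i| \le \ell$ for all $i \in [n]$, there are at most $L$ codewords $c \in C$ such that $c_i \in S_i$ for at least $(1-\rho)n$ of the indices $i \in [n]$. *)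

theory Defs
  imports Complex_Main "HOL-Library.FuncSet"
begin

text \<open>
  Words of length \<open>n\<close> over \<open>\<Sigma>\<close> are the extensional functions \<open>{1..n} \<rightarrow>\<^sub>E \<Sigma>\<close>, so
  distinct words differ at some index in \<open>{1..n}\<close> and \<open>card\<close> counts words.
  The finiteness conditions below are automatic for a finite alphabet; they only exclude the
  convention \<open>card A = 0\<close> for infinite \<open>A\<close>.
\<close>

definition list_recoverable ::
  "nat \<Rightarrow> 'a set \<Rightarrow> real \<Rightarrow> nat \<Rightarrow> nat \<Rightarrow> (nat \<Rightarrow> 'a) set \<Rightarrow> bool" where
  "list_recoverable n \<Sigma> \<rho> l L C \<longleftrightarrow>
     (\<forall>S :: nat \<Rightarrow> 'a set.
        (\<forall>i\<in>{1..n}. S i \<subseteq> \<Sigma> \<and> finite (S i) \<and> card (S i) \<le> l) \<longrightarrow>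
        (let A = {c \<in> C. real (card {i \<in> {1..n}. c i \<in> S i}) \<ge> (1 - \<rho>) * real n}
         in finite A \<and> card A \<le> L))"

end

theory Submission
  imports Defs
begin

text \<open>
  Write \<open>m = L + 1 - l\<close>. Fix a set \<open>A\<close> of about \<open>L * R * n / m\<close> coordinates and blocks
  \<open>T\<^sub>0, \<dots>, T\<^sub>L\<^sub>-\<^sub>1 \<subseteq> A\<close>, each of size about \<open>R * n\<close>, such that every coordinate of \<open>A\<close> lies in
  exactly \<open>m\<close> blocks. By pigeonhole there are distinct codewords \<open>c\<^sub>0, \<dots>, c\<^sub>L\<close> such that each
  \<open>c\<^sub>j\<close> with \<open>j < L\<close> agrees with \<open>c\<^sub>L\<close> on \<open>T\<^sub>j\<close>. On a coordinate of \<open>A\<close> these words take at most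
  \<open>L + 1 - m = l\<close> values, so a set of size \<open>l\<close> contains the symbols of all of them; on each
  other coordinate, cover \<open>l\<close> of the words, in round-robin order. Every word is then covered on about
  \<open>|A| + (n - |A|) * l / (L + 1) = n * (l + L * R) / (L + 1) \<ge> (1 - \<rho>) * n\<close> coordinates.
\<close>

section \<open>Cyclic blocks and their incidence counts\<close>

lemma card_residue_class_lessThan:
  fixes M N j :: nat
  assumes "j < N"
  shows "card {k. k < M \<and> k mod N = j} = M div N + (if j < M mod N then 1 else 0)"
proof (induction M)
  case 0
  then show ?case by simp
next
  case (Suc M)
  have "{k. k < Suc M \<and> k mod N = j}
      = (if M mod N = j then insert M {k. k < M \<and> k mod N = j} else {k. k < M \<and> k mod N = j})"
    by (auto simp: less_Suc_eq)
  then have "card {k. k < Suc M \<and> k mod N = j}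
      = card {k. k < M \<and> k mod N = j} + (if M mod N = j then 1 else 0)"
    by simp
  moreover have "M mod N < N" using assms by simp
  ultimately show ?case
    using Suc assms by (auto simp: mod_Suc div_Suc)
qed

text \<open>Intervals of length \<open>p\<close> are laid end to end around a cycle of length
  \<open>N\<close>; block \<open>i\<close> is the \<open>i\<close>-th of them. This round-robin
  order spreads the incidences over the cycle as evenly as possible.\<close>

definition cyc_block :: "nat \<Rightarrow> nat \<Rightarrow> nat \<Rightarrow> nat set" where
  "cyc_block N p i = (\<lambda>s. (i * p + s) mod N) ` {..<p}"

lemma eq_if_mod_eq_if_close:
  fixes x y :: nat
  assumes "x mod N = y mod N" "x < y + N" "y < x + N"
  shows "x = y"
proof -
  have *: "u = v" if "u mod N = v mod N" "v < u + N" "u \<le> v" for u v :: nat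
  proof -
    have "N dvd v - u" using that mod_eq_dvd_iff_nat by metis
    moreover have "v - u < N" using that by linarith
    ultimately show ?thesis using that nat_dvd_not_less by fastforce
  qed
  show ?thesis using *[of x y] *[of y x] assms by (cases "x \<le> y") auto
qed

lemma cyc_block_subset: "0 < N \<Longrightarrow> cyc_block N p i \<subseteq> {..<N}"
  by (auto simp: cyc_block_def)

lemma card_cyc_block:
  assumes "p \<le> N"
  shows "card (cyc_block N p i) = p"
proof -
  have "inj_on (\<lambda>s. (i * p + s) mod N) {..<p}"
  proof (rule inj_onI)
    fix s r assume sr: "s \<in> {..<p}" "r \<in> {..<p}" "(i * p + s) mod N = (i * p + r) mod N"
    then have "i * p + s < i * p + r + N" "i * p + r < i * p + s + N" using assms by auto
    with sr(3) have "i * p + s = i * p + r" by (rule eq_if_mod_eq_if_close)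
    then show "s = r" by simp
  qed
  then show ?thesis by (simp add: cyc_block_def card_image)
qed

text \<open>The first \<open>B\<close> intervals run through the positions \<open>k < B * p\<close>
  once each, position \<open>k\<close> lying in interval \<open>k div p\<close>. As
  \<open>p \<le> N\<close>, an interval meets the residue class of \<open>j\<close> at most once, so
  counting blocks through \<open>j\<close> amounts to counting that class.\<close>

lemma card_cyc_block_incidence:
  assumes "p \<le> N" "0 < p" "j < N"
  shows "card {i. i < B \<and> j \<in> cyc_block N p i}
       = B * p div N + (if j < B * p mod N then 1 else 0)"
proof -
  let ?K = "{k. k < B * p \<and> k mod N = j}"
  have "{i. i < B \<and> j \<in> cyc_block N p i} = (\<lambda>k. k div p) ` ?K" (is "?I = _")
  proof (intro subset_antisym subsetI)
    fix i assume "i \<in> ?I"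
    then obtain s where s: "i < B" "s < p" "j = (i * p + s) mod N"
      by (auto simp: cyc_block_def)
    have "i * p + s < (i + 1) * p" using s by simp
    also have "\<dots> \<le> B * p" using s by (intro mult_le_mono1) simp
    finally have K: "i * p + s \<in> ?K" using s by simp
    have "i = (i * p + s) div p" using s by simp
    then show "i \<in> (\<lambda>k. k div p) ` ?K" using K by (rule image_eqI)
  next
    fix i assume "i \<in> (\<lambda>k. k div p) ` ?K"
    then obtain k where k: "k < B * p" "k mod N = j" "i = k div p" by auto
    have "k = i * p + k mod p" "k mod p < p" using k(3) assms(2) by auto
    then have "j \<in> cyc_block N p i" using k(2) unfolding cyc_block_def by (auto intro!: image_eqI[of _ _ "k mod p"])
    moreover have "i < B" using k by (simp add: less_mult_imp_div_less)
    ultimately show "i \<in> ?I" by simp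
  qed
  moreover have "inj_on (\<lambda>k. k div p) ?K"
  proof (rule inj_onI)
    fix x y assume xy: "x \<in> ?K" "y \<in> ?K" "x div p = y div p"
    have "x = x div p * p + x mod p" "y = x div p * p + y mod p"
      using xy by (metis div_mult_mod_eq)+
    moreover have "x mod p < p" "y mod p < p" using assms by auto
    ultimately have "x < y + p" "y < x + p" using xy(3) by linarith+
    then have "x < y + N" "y < x + N" using assms(1) by linarith+
    moreover have "x mod N = y mod N" using xy by simp
    ultimately show "x = y" using eq_if_mod_eq_if_close by blast
  qed
  ultimately show ?thesis
    using card_residue_class_lessThan[OF assms(3)] by (simp add: card_image)
qed

section \<open>Pigeonhole: codewords that agree with a common one\<close>

lemma greedy_distinct_representatives:
  fixes B :: "nat \<Rightarrow> 'b set"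
  assumes "\<And>j. j < k \<Longrightarrow> j < card (B j)"
  shows "\<exists>f. inj_on f {..<k} \<and> (\<forall>j<k. f j \<in> B j)"
  using assms
proof (induction k)
  case 0
  then show ?case by simp
next
  case (Suc k)
  then obtain f where f: "inj_on f {..<k}" "\<forall>j<k. f j \<in> B j" by auto
  \<comment> \<open>The earlier choices occupy at most \<open>k\<close> elements, so
    \<open>B k\<close> still has a fresh one.\<close>
  have "card (f ` {..<k}) < card (B k)"
    using Suc.prems[of k] card_image_le[of "{..<k}" f] by simp
  then have "\<not> B k \<subseteq> f ` {..<k}"
    by (meson card_mono finite_imageI finite_lessThan leD)
  then obtain x where x: "x \<in> B k" "x \<notin> f ` {..<k}" by blast
  have "inj_on (f(k := x)) {..<Suc k}"
    using f x by (auto simp: inj_on_def less_Suc_eq)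
  moreover have "\<forall>j<Suc k. (f(k := x)) j \<in> B j"
    using f x by (auto simp: less_Suc_eq)
  ultimately show ?case by blast
qed

text \<open>Each value in \<open>Y\<close> accounts for at most \<open>s\<close> of the counted
  elements: its fibre either contributes none or has size at most \<open>s\<close>.\<close>

lemma card_small_fibres_le:
  assumes "finite C" "finite Y" "h ` C \<subseteq> Y"
  shows "card {c \<in> C. card {d \<in> C. h d = h c} \<le> s} \<le> s * card Y"
proof -
  let ?D = "{c \<in> C. card {d \<in> C. h d = h c} \<le> s}"
  have "card ?D \<le> card (\<Union>y\<in>Y. {d \<in> ?D. h d = y})"
    using assms by (intro card_mono) auto
  also have "\<dots> \<le> (\<Sum>y\<in>Y. card {d \<in> ?D. h d = y})"
    using assms(2) by (rule card_UN_le)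
  also have "\<dots> \<le> (\<Sum>y\<in>Y. s)"
  proof (rule sum_mono)
    fix y
    show "card {d \<in> ?D. h d = y} \<le> s"
    proof (cases "{d \<in> ?D. h d = y} = {}")
      case True
      then show ?thesis by (simp only: card.empty le0)
    next
      case False
      then obtain c where c: "c \<in> C" "card {d \<in> C. h d = h c} \<le> s" "h c = y" by blast
      then have "card {d \<in> ?D. h d = y} \<le> card {d \<in> C. h d = h c}"
        using assms(1) by (intro card_mono) auto
      then show ?thesis using c by simp
    qed
  qed
  finally show ?thesis by (simp add: mult.commute)
qed

text \<open>Call a codeword bad for \<open>j\<close> if at most \<open>L\<close> codewords, itself
  included, share its restriction to \<open>T j\<close>. There are at most
  \<open>card \<Sigma> ^ t\<close> restrictions, so a union bound over \<open>j\<close> leaves a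
  codeword that is bad for no \<open>j\<close>. It becomes the centre \<open>g L\<close>.\<close>

lemma exists_star_of_agreeing_codewords:
  fixes C :: "(nat \<Rightarrow> 'a) set"
  assumes "finite I" "C \<subseteq> I \<rightarrow>\<^sub>E \<Sigma>" "finite \<Sigma>" "0 < card \<Sigma>"
    and T: "\<And>j. j < L \<Longrightarrow> T j \<subseteq> I" "\<And>j. j < L \<Longrightarrow> card (T j) \<le> t"
    and big: "L * (L * card \<Sigma> ^ t) < card C"
  shows "\<exists>g. inj_on g {..L} \<and> g ` {..L} \<subseteq> C \<and> (\<forall>j<L. \<forall>i\<in>T j. g j i = g L i)"
proof -
  have finC: "finite C" using big card.infinite by fastforce
  define fib where "fib j c = {d \<in> C. restrict d (T j) = restrict c (T j)}" for j c
  define bad where "bad j = {c \<in> C. card (fib j c) \<le> L}" for j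
  have "card (bad j) \<le> L * card \<Sigma> ^ t" if "j < L" for j
  proof -
    have "(\<lambda>c. restrict c (T j)) ` C \<subseteq> T j \<rightarrow>\<^sub>E \<Sigma>"
      using assms(2) T(1)[OF that] by (fastforce simp: PiE_iff)
    moreover have finT: "finite (T j)" using T(1)[OF that] assms(1) by (rule finite_subset)
    ultimately have "card (bad j) \<le> L * card (T j \<rightarrow>\<^sub>E \<Sigma>)"
      unfolding bad_def fib_def using finC assms(3)
      by (intro card_small_fibres_le) (auto intro!: finite_PiE)
    also have "card (T j \<rightarrow>\<^sub>E \<Sigma>) = card \<Sigma> ^ card (T j)" using finT by (simp add: card_PiE)
    also have "L * \<dots> \<le> L * card \<Sigma> ^ t"
      using T(2)[OF that] assms(4) by (intro mult_le_mono2 power_increasing) auto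
    finally show ?thesis .
  qed
  then have "card (\<Union>j<L. bad j) \<le> L * (L * card \<Sigma> ^ t)"
    using card_UN_le[of "{..<L}" bad] sum_bounded_above[of "{..<L}" "\<lambda>j. card (bad j)" "L * card \<Sigma> ^ t"]
    by simp
  then have "\<not> C \<subseteq> (\<Union>j<L. bad j)"
    using big finC card_mono[of "\<Union>j<L. bad j" C] by (auto simp: bad_def)
  then obtain c where c: "c \<in> C" "\<And>j. j < L \<Longrightarrow> L < card (fib j c)"
    unfolding bad_def by fastforce
  \<comment> \<open>The centre is removed so that the companions differ from it; at least
    \<open>L\<close> candidates remain, enough for the greedy choice.\<close>
  have "j < card (fib j c - {c})" if "j < L" for j
    using c(1) c(2)[OF that] that by (simp add: fib_def)
  then obtain f where f: "inj_on f {..<L}" "\<forall>j<L. f j \<in> fib j c - {c}"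
    using greedy_distinct_representatives[of L "\<lambda>j. fib j c - {c}"] by blast
  define g where "g = f(L := c)"
  have "inj_on g {..L}"
    using f unfolding g_def inj_on_def by (auto simp: le_less)
  moreover have "g ` {..L} \<subseteq> C"
    using f c unfolding g_def fib_def by (auto simp: le_less)
  moreover have "g j i = g L i" if "j < L" "i \<in> T j" for i j
  proof -
    have "restrict (f j) (T j) = restrict c (T j)" using f that unfolding fib_def by auto
    then show ?thesis using that unfolding g_def by (metis fun_upd_apply less_irrefl restrict_apply')
  qed
  ultimately show ?thesis by blast
qed

section \<open>Input sets that cover too many codewords\<close>

lemma not_list_recoverable_if_cover:
  assumes fin: "finite \<Sigma>" and C: "C \<subseteq> {1..n} \<rightarrow>\<^sub>E \<Sigma>"
    and l: "1 \<le> l" "l \<le> L" and a: "a \<le> n"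
    and T: "\<And>j. j < L \<Longrightarrow> T j = {i \<in> {1..a}. j \<in> cyc_block L (L + 1 - l) (i - 1)}"
    and g: "inj_on g {..L}" "g ` {..L} \<subseteq> C" "\<forall>j<L. \<forall>i\<in>T j. g j i = g L i"
    and cover: "(1 - \<rho>) * real n \<le> real (a + (n - a) * l div (L + 1))"
  shows "\<not> list_recoverable n \<Sigma> \<rho> l L C"
proof
  assume rec: "list_recoverable n \<Sigma> \<rho> l L C"
  \<comment> \<open>\<open>J i\<close> holds the indices of the words whose symbols are put into
    \<open>S i\<close>. Up to \<open>a\<close> only the words of a block are left out, and these
    agree there with word \<open>L\<close>, which is never left out. Beyond \<open>a\<close> the
    \<open>L + 1\<close> words take turns, \<open>l\<close> at a time. The shifts make both block
    numberings start at 0.\<close>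
  define J where "J i = (if i \<le> a then {..L} - cyc_block L (L + 1 - l) (i - 1)
      else cyc_block (L + 1) l (i - a - 1))" for i
  define S where "S i = (\<lambda>j. g j i) ` J i" for i
  have JL: "J i \<subseteq> {..L}" for i
    using cyc_block_subset[of "L + 1" l "i - a - 1"] unfolding J_def by auto
  have cJ: "card (J i) = l" for i
  proof -
    have "cyc_block L (L + 1 - l) (i - 1) \<subseteq> {..L}"
      using cyc_block_subset[of L "L + 1 - l" "i - 1"] l by auto
    moreover have "finite (cyc_block L (L + 1 - l) (i - 1))" by (simp add: cyc_block_def)
    ultimately show ?thesis
      unfolding J_def using l by (simp add: card_Diff_subset card_cyc_block)
  qed
  have S: "S i \<subseteq> \<Sigma> \<and> finite (S i) \<and> card (S i) \<le> l" if "i \<in> {1..n}" for i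
  proof -
    have "finite (J i)" using JL finite_subset by blast
    moreover have "S i \<subseteq> \<Sigma>"
      using JL[of i] g(2) C that unfolding S_def by (force simp: PiE_iff)
    ultimately show ?thesis
      using card_image_le[of "J i" "\<lambda>j. g j i"] cJ[of i] unfolding S_def by simp
  qed
  define W where "W = {c \<in> C. real (card {i \<in> {1..n}. c i \<in> S i}) \<ge> (1 - \<rho>) * real n}"
  have W: "finite W" "card W \<le> L"
    using rec S unfolding list_recoverable_def W_def by (auto simp: Let_def)
  have "g j \<in> W" if "j \<le> L" for j
  proof -
    define K where "K = {i. i < n - a \<and> j \<in> cyc_block (L + 1) l i}"
    have inA: "g j i \<in> S i" if i: "i \<in> {1..a}" for i
    proof (cases "j \<in> J i")
      case False
      then have "j \<in> cyc_block L (L + 1 - l) (i - 1)"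
        using i \<open>j \<le> L\<close> unfolding J_def by auto
      moreover have lt: "cyc_block L (L + 1 - l) (i - 1) \<subseteq> {..<L}"
        using cyc_block_subset l by simp
      ultimately have "j < L" "i \<in> T j" using T i by auto
      then have "g j i = g L i" using g(3) by blast
      moreover have "L \<in> J i" using lt i unfolding J_def by auto
      ultimately show ?thesis unfolding S_def by auto
    qed (auto simp: S_def)
    have inK: "g j (i + a + 1) \<in> S (i + a + 1)" if "i \<in> K" for i
      using that unfolding S_def J_def K_def by auto
    have "finite K" unfolding K_def by simp
    then have "a + card K = card ({1..a} \<union> (\<lambda>i. i + a + 1) ` K)"
      by (subst card_Un_disjoint) (auto simp: card_image inj_on_def)
    also have "\<dots> \<le> card {i \<in> {1..n}. g j i \<in> S i}"
      using inA inK a by (intro card_mono) (auto simp: K_def)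
    finally have "a + card K \<le> card {i \<in> {1..n}. g j i \<in> S i}" .
    \<comment> \<open>Round-robin covers every word at least the rounded-down average number of
      times.\<close>
    moreover have "(n - a) * l div (L + 1) \<le> card K"
      unfolding K_def using l that by (subst card_cyc_block_incidence) auto
    ultimately have "real (a + (n - a) * l div (L + 1)) \<le> real (card {i \<in> {1..n}. g j i \<in> S i})"
      by linarith
    then show ?thesis unfolding W_def using cover g(2) that by auto
  qed
  then have "card (g ` {..L}) \<le> card W" using W by (intro card_mono) auto
  then show False using W g(1) by (simp add: card_image)
qed

section \<open>Arithmetic of the parameters\<close>

lemma list_recovery_threshold_iff:
  fixes L l R \<rho> :: real
  assumes "0 < L"
  shows "\<rho> \<ge> (L + 1 - l) / (L + 1) - L / (L + 1) * R
     \<longleftrightarrow> R \<ge> (L + 1 - l) / L - (L + 1) / L * \<rho>"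
proof -
  have "\<rho> \<ge> (L + 1 - l) / (L + 1) - L / (L + 1) * R \<longleftrightarrow> L + 1 - l - L * R \<le> \<rho> * (L + 1)"
    using assms by (simp add: pos_divide_le_eq flip: diff_divide_distrib)
  also have "\<dots> \<longleftrightarrow> L + 1 - l - (L + 1) * \<rho> \<le> R * L"
    by (auto simp: algebra_simps)
  also have "\<dots> \<longleftrightarrow> R \<ge> (L + 1 - l) / L - (L + 1) / L * \<rho>"
    using assms by (simp add: pos_divide_le_eq flip: diff_divide_distrib)
  finally show ?thesis .
qed

lemma exists_covered_part:
  fixes L l n :: nat and R \<rho> :: real
  assumes l: "1 \<le> l" "l \<le> L" and "0 \<le> R" "0 \<le> \<rho>"
    and thr: "\<rho> \<ge> (real L + 1 - real l) / (real L + 1) - real L / (real L + 1) * R"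
  shows "\<exists>a\<le>n. real (a * (L + 1 - l)) \<le> real L * R * real n + 2 * real L + 1
           \<and> (1 - \<rho>) * real n \<le> real (a + (n - a) * l div (L + 1))"
proof -
  define m where "m = L + 1 - l"
  \<comment> \<open>The summand \<open>L + 1\<close> pays for the rounding in
    \<open>div (L + 1)\<close>, which loses less than 1 coordinate per word.\<close>
  define x where "x = (real L * R * real n + real L + 1) / real m"
  have m: "1 \<le> m" "m \<le> L" "real m = real L + 1 - real l" using l by (auto simp: m_def)
  have x0: "0 \<le> x" using assms unfolding x_def by simp
  define a where "a = min n (nat \<lceil>x\<rceil>)"
  have "real a \<le> x + 1" using x0 unfolding a_def by linarith
  then have "real a * real m \<le> (x + 1) * real m" by (intro mult_right_mono) auto
  also have "\<dots> = real L * R * real n + real L + 1 + real m"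
    using m unfolding x_def by (simp add: field_simps)
  finally have up: "real (a * m) \<le> real L * R * real n + 2 * real L + 1" using m by simp
  have "(1 - \<rho>) * real n \<le> real (a + (n - a) * l div (L + 1))"
  proof (cases "a = n")
    case True
    have "(1 - \<rho>) * real n \<le> 1 * real n" using assms by (intro mult_right_mono) auto
    then show ?thesis using True by simp
  next
    case False
    then have "a < n" "real a \<ge> x" using x0 unfolding a_def by linarith+
    then have "real a * real m \<ge> x * real m" by (intro mult_right_mono) auto
    then have am: "real a * real m \<ge> real L * R * real n + real L + 1"
      using m unfolding x_def by simp
    define d where "d = (n - a) * l div (L + 1)"
    have "(n - a) * l < (d + 1) * (L + 1)"
      unfolding d_def using dividend_less_div_times[of "L + 1" "(n - a) * l"] by (simp add: algebra_simps)
    then have "real ((n - a) * l) < real ((d + 1) * (L + 1))" by (simp only: of_nat_less_iff)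
    then have d: "(real n - real a) * real l < (real d + 1) * (real L + 1)"
      using \<open>a < n\<close> by (simp add: of_nat_diff algebra_simps)
    have "real m - real L * R \<le> \<rho> * (real L + 1)"
      using thr m by (simp add: pos_divide_le_eq flip: diff_divide_distrib)
    then have "(real m - real L * R) * real n \<le> \<rho> * (real L + 1) * real n"
      by (intro mult_right_mono) auto
    \<comment> \<open>With \<open>d\<close> rounded down, \<open>(a + d) * (L + 1)\<close> exceeds
      \<open>n * l + a * m - (L + 1)\<close>, which is at least \<open>n * (l + L * R)\<close> by
      the choice of \<open>a\<close>; the threshold bounds this below by the left side.\<close>
    then have "((1 - \<rho>) * real n) * (real L + 1) \<le> (real a + real d) * (real L + 1)"
      using am d m(3) by (simp add: algebra_simps)
    then show ?thesis by (simp add: d_def)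
  qed
  then show ?thesis using up unfolding m_def a_def by (intro exI[of _ a]) (simp add: a_def)
qed

text \<open>The factor \<open>L * L\<close> is below \<open>q ^ (2 * L)\<close> since
  \<open>L < 2 ^ L\<close>. Together with the slack 3 in \<open>t\<close> this costs an exponent
  \<open>2 * L + 3\<close>, at most \<open>5 * L\<close>.\<close>

lemma code_size_bound:
  fixes L t q :: nat and y :: real
  assumes "2 \<le> q" "1 \<le> L" "real t \<le> y + 3" "q powr (y + 5 * real L) \<le> real N"
  shows "L * (L * q ^ t) < N"
proof -
  have "L * L < 2 ^ L * 2 ^ L"
    using less_exp[of L] by (intro mult_strict_mono) auto
  also have "\<dots> \<le> q ^ L * q ^ L"
    using assms by (intro mult_le_mono power_mono) auto
  finally have "L * L < q ^ L * q ^ L" .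
  then have "L * L * q ^ t < q ^ L * q ^ L * q ^ t" using assms by simp
  also have "\<dots> = q ^ (t + 2 * L)" by (simp only: power_add mult_2) (simp only: mult_ac)
  finally have "real (L * (L * q ^ t)) < real (q ^ (t + 2 * L))"
    by (simp only: of_nat_less_iff mult.assoc)
  also have "\<dots> = real q powr real (t + 2 * L)" using assms by (subst powr_realpow) auto
  also have "\<dots> \<le> real q powr (y + 5 * real L)" using assms by (intro powr_mono) auto
  finally show ?thesis using assms(4) by linarith
qed

theorem theorem3p2:
  fixes L l n q :: nat and \<Sigma> :: "'a set" and R \<rho> :: real
  assumes "1 \<le> l" and "l \<le> L" and "1 \<le> n"
    and "finite \<Sigma>" and "card \<Sigma> = q" and "2 \<le> q"
    and "0 \<le> R" and "R \<le> 1" and "0 \<le> \<rho>" and "\<rho> \<le> 1"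
  shows "(\<rho> \<ge> (real L + 1 - real l) / (real L + 1) - real L / (real L + 1) * R
            \<longleftrightarrow> R \<ge> (real L + 1 - real l) / real L - (real L + 1) / real L * \<rho>)
       \<and> (\<rho> \<ge> (real L + 1 - real l) / (real L + 1) - real L / (real L + 1) * R
            \<longrightarrow> (\<forall>C. C \<subseteq> {1..n} \<rightarrow>\<^sub>E \<Sigma> \<and> real (card C) \<ge> real q powr (R * real n + 5 * real L)
                    \<longrightarrow> \<not> list_recoverable n \<Sigma> \<rho> l L C))"
proof (intro conjI impI allI)
  show "\<rho> \<ge> (real L + 1 - real l) / (real L + 1) - real L / (real L + 1) * R
     \<longleftrightarrow> R \<ge> (real L + 1 - real l) / real L - (real L + 1) / real L * \<rho>"
    using assms by (intro list_recovery_threshold_iff) simp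
next
  fix C assume thr: "\<rho> \<ge> (real L + 1 - real l) / (real L + 1) - real L / (real L + 1) * R"
    and "C \<subseteq> {1..n} \<rightarrow>\<^sub>E \<Sigma> \<and> real (card C) \<ge> real q powr (R * real n + 5 * real L)"
  then have C: "C \<subseteq> {1..n} \<rightarrow>\<^sub>E \<Sigma>" "real q powr (R * real n + 5 * real L) \<le> real (card C)"
    by auto
  define m where "m = L + 1 - l"
  have m: "1 \<le> m" "m \<le> L" and L: "1 \<le> L" using assms by (auto simp: m_def)
  obtain a where a: "a \<le> n" "real (a * m) \<le> real L * R * real n + 2 * real L + 1"
      "(1 - \<rho>) * real n \<le> real (a + (n - a) * l div (L + 1))"
    using exists_covered_part[OF assms(1,2) assms(7) assms(9) thr, of n] unfolding m_def by blast
  \<comment> \<open>The ceiling of \<open>a * m / L\<close>, the average size of the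
    \<open>L\<close> sets \<open>T j\<close>: the \<open>a\<close> coordinates lie in
    \<open>m\<close> of them each.\<close>
  define t where "t = (a * m + L - 1) div L"
  \<comment> \<open>Transposed incidence: coordinate \<open>i\<close> belongs to the sets
    \<open>T j\<close> whose indices form its cyclic block. Hence the sizes of the
    \<open>T j\<close> differ by at most 1.\<close>
  define T where "T j = {i \<in> {1..a}. j \<in> cyc_block L m (i - 1)}" for j
  have cT: "card (T j) \<le> t" if "j < L" for j
  proof -
    have "T j = Suc ` {i. i < a \<and> j \<in> cyc_block L m i}"
    proof (intro subset_antisym subsetI)
      fix i assume "i \<in> T j"
      then show "i \<in> Suc ` {i. i < a \<and> j \<in> cyc_block L m i}"
        unfolding T_def by (cases i) auto
    qed (auto simp: T_def)
    then have "card (T j) = a * m div L + (if j < a * m mod L then 1 else 0)"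
      using card_cyc_block_incidence[of m L j a] m that by (simp add: card_image)
    also have "\<dots> * L \<le> a * m + L - 1"
    proof (cases "j < a * m mod L")
      case True
      then have "1 \<le> a * m mod L" by simp
      then show ?thesis
        using True div_mult_mod_eq[of "a * m" L] L unfolding if_P[OF True] add_mult_distrib by linarith
    next
      case False
      then show ?thesis
        using div_mult_mod_eq[of "a * m" L] L unfolding if_not_P[OF False] add_0_right by linarith
    qed
    finally show ?thesis
      unfolding t_def using L by (simp add: less_eq_div_iff_mult_less_eq)
  qed
  have "t * L \<le> a * m + L - 1" unfolding t_def by simp
  then have "real t * real L \<le> real (a * m) + real L - 1"
    using L by (simp add: of_nat_diff flip: of_nat_mult of_nat_add)
  \<comment> \<open>The slack \<open>2 * L + 1\<close> from the choice of \<open>a\<close> and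
    \<open>L - 1\<close> from the ceiling add up to \<open>3 * L\<close>.\<close>
  then have "real t * real L \<le> (R * real n + 3) * real L" using a(2) by (simp add: algebra_simps)
  then have "real t \<le> R * real n + 3" using L by simp
  then have "L * (L * card \<Sigma> ^ t) < card C"
    using C(2) assms(5,6) L by (intro code_size_bound) auto
  moreover have "T j \<subseteq> {1..n}" for j using a(1) unfolding T_def by auto
  ultimately obtain g where "inj_on g {..L}" "g ` {..L} \<subseteq> C" "\<forall>j<L. \<forall>i\<in>T j. g j i = g L i"
    using exists_star_of_agreeing_codewords[of "{1..n}" C \<Sigma> L T t] C(1) cT assms(4,5,6) by auto
  then show "\<not> list_recoverable n \<Sigma> \<rho> l L C"
    using assms(1,2,4) C(1) a(1,3)
    by (intro not_list_recoverable_if_cover[where T = T and g = g and a = a]) (auto simp: T_def m_def)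
qed

end
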